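(* Let $B=(VB,EB)$ be a finite simple bipartite graph with $VB=V_1\cup V_2$ (disjoint), $V_1=\{1,2,\dots,n\}$, $V_2=\{v_1,\dots,v_m\}$, every edge joining a vertex of $V_1$ to a vertex of $V_2$. Assume that $B$ is symmetric in the sense that for any permutation $\pi$ of $V_1$ there exists a permutation $\sigma$ of $V_2$ such that the combination of $\pi$ and $\sigma$ (acting as $\pi$ on $V_1$ and as $\sigma$ on $V_2$) is an automorphism of $B$. Then $$\mathrm{vol}(B)=n!\prod_{i=1}^n\frac{1}{i+\sum_{j=1}^i\alpha_j},$$ where $\alpha_j$ denotes the common value of $\alpha_{j,\sigma}$ over all permutations $\sigma$ of $\{1,\dots,n\}$ (these values coincide by the symmetry of $B$).
   Context: For a finite simple graph $G=(VG,EG)$, the graph polytope is $P(G)=\{x\in[0,1]^{VG} : x_i+x_j\le 1 \text{ for every edge } ij\in EG\}$, and $\mathrm{vol}(G)$ denotes the $|VG|$-dimensional volume (Lebesgue measure) of $P(G)$. For $B$ as in the claim, $N_k=\{j\in V_1 : jv_k\in EB\}$ for $1\le k\le m$, and for a permutation $\sigma$ of $\{1,\dots,n\}$ and $1\le i\le n$, $\alpha_{i,\sigma}=\big|\{v_k\in V_2 : \sigma(i)\in N_k\}\setminus\bigcup_{j=1}^{i-1}\{v_k\in V_2 : \sigma(j)\in N_k\}\big|$. An automorphism of a simple graph is a permutation $\pi$ of its vertices such that $uv$ is an edge if and only if $\pi(u)\pi(v)$ is an edge. *)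

theory Defs
  imports
    "HOL-Analysis.Analysis"
    "HOL-Combinatorics.Permutations"
    "Graph_Theory.Pair_Digraph"
begin

text \<open>
  A finite simple graph is a \<open>pair_graph\<close>: a finite vertex set \<open>pverts G\<close> with a symmetric,
  loop-free adjacency relation \<open>parcs G\<close>. The edge \<open>ij\<close> is represented by
  the two pairs \<open>(i, j)\<close> and \<open>(j, i)\<close>.
\<close>

definition graph_polytope :: "'a pair_pre_digraph \<Rightarrow> ('a \<Rightarrow> real) set" where
  "graph_polytope G =
     {x \<in> pverts G \<rightarrow>\<^sub>E {0..1}. \<forall>(i, j) \<in> parcs G. x i + x j \<le> 1}"

text \<open>
  The coordinate space indexed by the vertices consists of the functions that are
  \<open>undefined\<close> outside \<open>pverts G\<close>; its Lebesgue measure is the product measure.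
  The polytope is a Borel set, so no completion is needed.
\<close>

definition graph_volume :: "'a pair_pre_digraph \<Rightarrow> real" where
  "graph_volume G = measure (Pi\<^sub>M (pverts G) (\<lambda>_. lborel)) (graph_polytope G)"

definition graph_automorphism :: "'a pair_pre_digraph \<Rightarrow> ('a \<Rightarrow> 'a) \<Rightarrow> bool" where
  "graph_automorphism G \<pi> \<longleftrightarrow>
     \<pi> permutes pverts G \<and>
     (\<forall>u\<in>pverts G. \<forall>w\<in>pverts G. (u, w) \<in> parcs G \<longleftrightarrow> (\<pi> u, \<pi> w) \<in> parcs G)"

text \<open>
  In the bipartite graphs below the vertex \<open>j \<in> {1..n}\<close> of the first class is \<open>Inl j\<close> and the
  vertex \<open>v k\<close> (\<open>k \<in> {1..m}\<close>) of the second class is \<open>Inr (v k)\<close>, which makes the two classes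
  disjoint. For permutations \<open>\<pi>\<close> of \<open>{1..n}\<close> and \<open>\<sigma>\<close> of \<open>v ` {1..m}\<close>, the combined map is
  \<open>map_sum \<pi> \<sigma>\<close>.
\<close>

definition bip_nbrs ::
    "(nat + 'b) pair_pre_digraph \<Rightarrow> nat \<Rightarrow> (nat \<Rightarrow> 'b) \<Rightarrow> nat \<Rightarrow> nat set" where
  "bip_nbrs B n v k = {j \<in> {1..n}. (Inl j, Inr (v k)) \<in> parcs B}"

definition bip_alpha ::
    "(nat + 'b) pair_pre_digraph \<Rightarrow> nat \<Rightarrow> nat \<Rightarrow> (nat \<Rightarrow> 'b) \<Rightarrow> nat \<Rightarrow> (nat \<Rightarrow> nat) \<Rightarrow> nat" where
  "bip_alpha B n m v i \<sigma> =
     card ({v k | k. k \<in> {1..m} \<and> \<sigma> i \<in> bip_nbrs B n v k} -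
           (\<Union>j\<in>{1..<i}. {v k | k. k \<in> {1..m} \<and> \<sigma> j \<in> bip_nbrs B n v k}))"

end

theory Submission
  imports Defs
begin

text \<open>
  For fixed coordinates \<open>x\<close> on the first class, the coordinate at a vertex \<open>k\<close> of the second class
  ranges over \<open>[0, min\<^sub>j (1 - x\<^sub>j)]\<close>, \<open>j\<close> running over the neighbours of \<open>k\<close>, so the volume is the
  integral over \<open>[0,1]\<^sup>n\<close> of the product of these minima. By symmetry the number of vertices of the
  second class with a neighbour in \<open>T\<close> is a function \<open>c\<close> of \<open>card T\<close> alone, and
  \<open>c i = \<alpha>\<^sub>1 + \<dots> + \<alpha>\<^sub>i\<close>. The least coordinate matters only for the vertices of the second class
  with no other neighbour; integrating it last reduces \<open>n\<close> by one and yields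
  the factor \<open>n / (n + c n)\<close>.
\<close>

section \<open>Measurability of the polytope\<close>

lemma component_lborel_measurable:
  "i \<in> I \<Longrightarrow> (\<lambda>x. x i) \<in> borel_measurable (Pi\<^sub>M I (\<lambda>_. lborel :: real measure))"
  using measurable_component_singleton[of i I "\<lambda>_. lborel :: real measure"] by simp

lemma sets_graph_polytope:
  assumes "pair_graph G"
  shows "graph_polytope G \<in> sets (Pi\<^sub>M (pverts G) (\<lambda>_. lborel))"
proof -
  interpret pair_graph G by fact
  let ?M = "Pi\<^sub>M (pverts G) (\<lambda>_. lborel :: real measure)"
  have eq: "graph_polytope G = {x \<in> space ?M. (\<forall>i\<in>pverts G. 0 \<le> x i \<and> x i \<le> 1) \<and>
      (\<forall>e\<in>parcs G. x (fst e) + x (snd e) \<le> 1)}"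
    by (auto simp: graph_polytope_def space_PiM PiE_iff)
  have [measurable]: "(\<lambda>x. x (fst e)) \<in> borel_measurable ?M"
    "(\<lambda>x. x (snd e)) \<in> borel_measurable ?M" if "e \<in> parcs G" for e
    using that in_arcsD1[of "fst e" "snd e"] in_arcsD2[of "fst e" "snd e"]
    by (auto intro: component_lborel_measurable)
  show ?thesis
    unfolding eq by measurable
qed

section \<open>The upper bound for a coordinate of the second class\<close>

text \<open>
  The constant \<open>1\<close> covers \<open>A = {}\<close>, where \<open>Min\<close> is unspecified, and is inert for \<open>x \<ge> 0\<close> otherwise.
\<close>

definition gap :: "'a set \<Rightarrow> ('a \<Rightarrow> real) \<Rightarrow> real" where
  "gap A x = Min (insert 1 ((\<lambda>j. 1 - x j) ` A))"

text \<open>Comparisons of gaps and membership in \<open>{0..gap A x}\<close> go through the lower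
  bounds \<open>z\<close>, so that \<open>Min\<close> need not be handled.\<close>

lemma le_gap_iff:
  assumes "finite A"
  shows "z \<le> gap A x \<longleftrightarrow> z \<le> 1 \<and> (\<forall>j\<in>A. z + x j \<le> 1)"
  using assms by (auto simp: gap_def algebra_simps)

lemma gap_cong: "(\<And>j. j \<in> A \<Longrightarrow> x j = y j) \<Longrightarrow> gap A x = gap A y"
  by (auto simp: gap_def intro!: arg_cong[where f = Min])

lemma gap_empty [simp]: "gap {} x = 1"
  by (simp add: gap_def)

lemma gap_singleton: "0 \<le> x i \<Longrightarrow> gap {i} x = 1 - x i"
  by (simp add: gap_def)

text \<open>The bound \<open>z + x j \<le> 1\<close> at a larger coordinate already implies the
  bound at \<open>i\<close>.\<close>

lemma gap_remove_min:
  assumes "finite A" "j \<in> A" "j \<noteq> i" "x i \<le> x j"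
  shows "gap A x = gap (A - {i}) x"
proof (rule antisym)
  have "z \<le> gap A x \<longleftrightarrow> z \<le> gap (A - {i}) x" for z
  proof -
    have "z + x i \<le> 1" if "\<forall>j\<in>A - {i}. z + x j \<le> 1"
      using bspec[OF that, of j] assms by simp
    then show ?thesis
      using assms(1) by (auto simp: le_gap_iff)
  qed
  then show "gap A x \<le> gap (A - {i}) x" "gap (A - {i}) x \<le> gap A x"
    by auto
qed

lemma borel_measurable_gap [measurable (raw)]:
  assumes "finite A" "A \<subseteq> I"
  shows "gap A \<in> borel_measurable (Pi\<^sub>M I (\<lambda>_. lborel))"
  using assms
proof (induction A rule: finite_induct)
  case empty
  then show ?case by (simp add: gap_def[abs_def])
next
  case (insert a A)
  have "gap (insert a A) = (\<lambda>x. min (1 - x a) (gap A x))"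
    using insert.hyps
    by (auto simp: gap_def fun_eq_iff insert_commute[of 1] Min_insert)
  moreover have [measurable]: "(\<lambda>x. x a) \<in> borel_measurable (Pi\<^sub>M I (\<lambda>_. lborel :: real measure))"
    using insert.prems by (auto intro: component_lborel_measurable)
  moreover have [measurable]: "gap A \<in> borel_measurable (Pi\<^sub>M I (\<lambda>_. lborel))"
    using insert by auto
  ultimately show ?case by simp
qed

section \<open>Ties between coordinates and a one-dimensional integral\<close>

interpretation lborel_product: product_sigma_finite "\<lambda>_. lborel :: real measure"
  by unfold_locales

text \<open>For \<open>i \<noteq> j\<close> each line in direction \<open>i\<close> meets the set
  \<open>x i = x j\<close> in a single point, so this set is null by Tonelli, and there are only
  finitely many pairs.\<close>

lemma AE_PiM_lborel_inj_on:
  assumes "finite S"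
  shows "AE x in Pi\<^sub>M S (\<lambda>_. lborel :: real measure). inj_on x S"
proof -
  let ?M = "\<lambda>I. Pi\<^sub>M I (\<lambda>_. lborel :: real measure)"
  have "AE x in ?M S. x i \<noteq> x j" if ij: "i \<in> S" "j \<in> S" "i \<noteq> j" for i j
  proof -
    let ?E = "{x \<in> space (?M S). x i = x j}"
    define I where "I = S - {i}"
    have S: "S = insert i I" "finite I" "i \<notin> I" "j \<in> I"
      using assms ij by (auto simp: I_def)
    have [measurable]: "(\<lambda>x. x i) \<in> borel_measurable (?M S)" "(\<lambda>x. x j) \<in> borel_measurable (?M S)"
      using ij by (auto intro: component_lborel_measurable)
    have E: "?E \<in> sets (?M S)" by measurable
    have "emeasure (?M S) ?E = (\<integral>\<^sup>+x. indicator ?E x \<partial>?M (insert i I))"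
      using E S(1) by simp
    also have "\<dots> = (\<integral>\<^sup>+x. \<integral>\<^sup>+y. indicator ?E (x(i := y)) \<partial>lborel \<partial>?M I)"
      using S E by (intro lborel_product.product_nn_integral_insert) auto
    also have "\<dots> = (\<integral>\<^sup>+x. \<integral>\<^sup>+y. indicator {x j} y \<partial>lborel \<partial>?M I)"
      using S ij
      by (intro nn_integral_cong) (auto simp: indicator_def space_PiM PiE_iff extensional_def)
    also have "\<dots> = 0" by simp
    finally show ?thesis
      using E by (intro AE_I[of _ _ ?E]) auto
  qed
  then have "AE x in ?M S. \<forall>i\<in>S. \<forall>j\<in>S. i \<noteq> j \<longrightarrow> x i \<noteq> x j"
    using assms by (intro AE_finite_allI) (auto)
  then show ?thesis
    by eventually_elim (auto simp: inj_on_def)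
qed

text \<open>Serves for the integral over the least coordinate. The antiderivative is chosen to
  vanish at \<open>1\<close>.\<close>

lemma nn_integral_one_minus_power:
  fixes b :: real
  assumes "b \<le> 1"
  shows "(\<integral>\<^sup>+y. ennreal ((1 - y) ^ p) * indicator {b..1} y \<partial>lborel) =
    ennreal ((1 - b) ^ Suc p / real (Suc p))"
proof -
  have "((\<lambda>y. - ((1 - y) ^ Suc p / real (Suc p))) has_real_derivative (1 - y) ^ p) (at y)" for y :: real
    by (auto intro!: derivative_eq_intros simp del: power_Suc of_nat_Suc)
  then have "(\<integral>\<^sup>+y. ennreal ((1 - y) ^ p) * indicator {b..1} y \<partial>lborel) =
      ennreal (- ((1 - 1) ^ Suc p / real (Suc p)) - - ((1 - b) ^ Suc p / real (Suc p)))"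
    using assms by (intro nn_integral_FTC_Icc) auto
  then show ?thesis by simp
qed

section \<open>The integral of a product of gaps over a cube\<close>

text \<open>
  Splitting \<open>[b,1]\<^sup>S\<close> according to the position \<open>i\<close> of the least coordinate \<open>y\<close> leaves the
  same integral over \<open>[y,1]\<close> to the power \<open>S - {i}\<close>; keeping \<open>b\<close> general avoids rescaling.
\<close>

lemma nn_integral_prod_gap:
  fixes N :: "'k \<Rightarrow> 'a set" and b :: real
  assumes "finite S" "finite K"
    and "\<And>T. T \<subseteq> S \<Longrightarrow> card {k \<in> K. N k \<inter> T \<noteq> {}} = c (card T)"
    and "0 \<le> b" "b \<le> 1"
  shows "(\<integral>\<^sup>+x. (\<Prod>j\<in>S. indicator {b..1} (x j)) * (\<Prod>k\<in>K. ennreal (gap (N k \<inter> S) x))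
      \<partial>Pi\<^sub>M S (\<lambda>_. lborel)) =
    ennreal ((1 - b) ^ (card S + c (card S)) * (\<Prod>i=1..card S. real i / real (i + c i)))"
  using assms
proof (induction "card S" arbitrary: S b)
  case 0
  moreover from 0 have "S = {}" by simp
  \<comment> \<open>The exponent is thus \<open>0\<close>, and both sides equal
    \<open>1\<close>.\<close>
  moreover have "c 0 = 0" using 0(4)[of "{}"] by simp
  ultimately show ?case by (simp add: PiM_empty)
next
  case (Suc n)
  let ?M = "\<lambda>I. Pi\<^sub>M I (\<lambda>_. lborel :: real measure)"
  define P where "P = (\<Prod>i=1..n. real i / real (i + c i))"
  \<comment> \<open>Index set and lower bound are parameters because the recursion passes from
    \<open>S\<close> and \<open>b\<close> to \<open>S - {i}\<close> and \<open>y\<close>.\<close>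
  define f where "f S b x = (\<Prod>j\<in>S. indicator {b..1} (x j)) * (\<Prod>k\<in>K. ennreal (gap (N k \<inter> S) x))"
    for S and b :: real and x :: "'a \<Rightarrow> real"
  \<comment> \<open>The weak inequality makes the pieces cover the space; they overlap only where
    coordinates tie.\<close>
  define D where "D i = {x \<in> space (?M S). \<forall>j\<in>S. x i \<le> x j}" for i
  have P_nonneg: "0 \<le> P" by (auto simp: P_def intro!: prod_nonneg)
  have S: "finite S" "card S = Suc n" using Suc by auto
  have [measurable]: "(\<lambda>x. x i) \<in> borel_measurable (?M I)" if "i \<in> I" for i :: 'a and I
    using that by (auto intro: component_lborel_measurable)
  have f_borel: "f I b \<in> borel_measurable (?M I)" if "finite I" for I b
  proof -
    have [measurable]: "gap (N k \<inter> I) \<in> borel_measurable (?M I)" for k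
      using that by (auto intro: borel_measurable_gap)
    show ?thesis unfolding f_def by measurable
  qed
  have f_meas [measurable]: "f S b \<in> borel_measurable (?M S)" for b
    using S(1) by (rule f_borel)
  have D_meas [measurable]: "D i \<in> sets (?M S)" if "i \<in> S" for i
    unfolding D_def using S(1) that
    by (auto intro!: sets.sets_Collect_finite_All borel_measurable_le component_lborel_measurable)
  \<comment> \<open>The value is the same for every \<open>i\<close>, since \<open>c\<close> sees
    only cardinalities.\<close>
  have part: "(\<integral>\<^sup>+x. f S b x * indicator (D i) x \<partial>?M S) =
      ennreal (P * ((1 - b) ^ (Suc n + c (Suc n)) / real (Suc n + c (Suc n))))" if i: "i \<in> S" for i
  proof -
    define I where "I = S - {i}"
    define a where "a = card {k \<in> K. N k \<inter> S = {i}}"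
    have I: "S = insert i I" "finite I" "i \<notin> I" "card I = n"
      using S i by (auto simp: I_def)
    have card_T: "card {k \<in> K. N k \<inter> T \<noteq> {}} = c (card T)" if "T \<subseteq> S" for T
      using Suc.prems(3) that .
    \<comment> \<open>If \<open>N k\<close> meets \<open>S\<close>, it meets it in \<open>i\<close>
      alone or it meets \<open>I\<close>. Hence \<open>a\<close> is the increment of
      \<open>c\<close>, whichever \<open>i\<close> is chosen.\<close>
    have "{k \<in> K. N k \<inter> S \<noteq> {}} = {k \<in> K. N k \<inter> S = {i}} \<union> {k \<in> K. N k \<inter> I \<noteq> {}}"
      using i by (auto simp: I_def)
    then have "card {k \<in> K. N k \<inter> S \<noteq> {}} = a + card {k \<in> K. N k \<inter> I \<noteq> {}}"
      using Suc.prems(2) unfolding a_def by (subst card_Un_disjoint[symmetric]) (auto simp: I_def)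
    with card_T[of S] card_T[of I] I S have c_Suc: "c (Suc n) = a + c n"
      by auto
    \<comment> \<open>If \<open>y\<close> is least, the \<open>a\<close> indices \<open>k\<close>
      with \<open>N k \<inter> S = {i}\<close> contribute \<open>1 - y\<close> each and the other
      gaps do not depend on \<open>y\<close>. Membership in \<open>D i\<close> turns into the new
      lower bound \<open>y\<close> for the remaining coordinates. Outside these ranges both sides
      vanish.\<close>
    have slice: "f S b (x(i := y)) * indicator (D i) (x(i := y)) =
        (ennreal ((1 - y) ^ a) * indicator {b..1} y) * f I y x"
      if x: "x \<in> space (?M I)" for x y
    proof (cases "y \<in> {b..1} \<and> (\<forall>j\<in>I. x j \<in> {y..1})")
      case True
      have "ennreal (gap (N k \<inter> S) (x(i := y))) =
          (if N k \<inter> S = {i} then ennreal (1 - y) else 1) * ennreal (gap (N k \<inter> I) x)" for k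
      proof (cases "N k \<inter> S = {i}")
        case A: True
        then have "N k \<inter> I = {}" by (auto simp: I_def)
        \<comment> \<open>As \<open>0 \<le> b \<le> y\<close>, the constant \<open>1\<close> inside
          \<open>gap\<close> does not cut off \<open>1 - y\<close>.\<close>
        with A True Suc.prems show ?thesis by (simp add: gap_singleton)
      next
        case B: False
        have "gap (N k \<inter> S) (x(i := y)) = gap (N k \<inter> S - {i}) (x(i := y))"
        proof (cases "i \<in> N k \<inter> S")
          case True
          with B obtain j where "j \<in> N k \<inter> S" "j \<noteq> i" by auto
          with \<open>y \<in> {b..1} \<and> (\<forall>j\<in>I. x j \<in> {y..1})\<close> S show ?thesis
            by (intro gap_remove_min[of _ j]) (auto simp: I_def)
        qed simp
        also have "\<dots> = gap (N k \<inter> I) x"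
          by (subst Int_Diff, fold I_def) (rule gap_cong, use I in auto)
        finally show ?thesis using B by simp
      qed
      then have "(\<Prod>k\<in>K. ennreal (gap (N k \<inter> S) (x(i := y)))) =
          (\<Prod>k\<in>K. if N k \<inter> S = {i} then ennreal (1 - y) else 1) * (\<Prod>k\<in>K. ennreal (gap (N k \<inter> I) x))"
        by (simp add: prod.distrib)
      also have "(\<Prod>k\<in>K. if N k \<inter> S = {i} then ennreal (1 - y) else 1) = ennreal ((1 - y) ^ a)"
        using Suc.prems(2) True
        by (simp add: prod.inter_filter[symmetric] a_def ennreal_power)
      finally have "(\<Prod>k\<in>K. ennreal (gap (N k \<inter> S) (x(i := y)))) =
          ennreal ((1 - y) ^ a) * (\<Prod>k\<in>K. ennreal (gap (N k \<inter> I) x))" .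
      moreover have "x(i := y) \<in> D i"
        using x True I by (auto simp: D_def space_PiM PiE_iff extensional_def)
      moreover have "(\<Prod>j\<in>S. indicator {b..1} ((x(i := y)) j)) = (1 :: ennreal)"
        using True I by (intro prod.neutral) (auto simp: indicator_def)
      moreover have "(\<Prod>j\<in>I. indicator {y..1} (x j)) = (1 :: ennreal)"
        using True by (intro prod.neutral) (auto simp: indicator_def)
      ultimately show ?thesis using True by (simp add: f_def)
    next
      case False
      then consider "y \<notin> {b..1}" | j where "j \<in> I" "x j < y" | j where "j \<in> I" "x j > 1"
        by force
      then show ?thesis
      proof cases
        case 1
        then have "(\<Prod>j\<in>S. indicator {b..1} ((x(i := y)) j)) = (0 :: ennreal)"
          using S i by (intro prod_zero) (auto intro!: bexI[of _ i])
        then show ?thesis using 1 by (simp add: f_def)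
      next
        case 2
        then have "j \<in> S" "j \<noteq> i" using I by auto
        with 2 have "x(i := y) \<notin> D i" by (auto simp: D_def intro!: bexI[of _ j])
        moreover from 2 have "(\<Prod>j\<in>I. indicator {y..1} (x j)) = (0 :: ennreal)"
          using I by (intro prod_zero) (auto intro!: bexI[of _ j])
        ultimately show ?thesis by (simp add: f_def)
      next
        case 3
        then have "(\<Prod>j\<in>S. indicator {b..1} ((x(i := y)) j)) = (0 :: ennreal)"
          using I S by (intro prod_zero) (auto intro!: bexI[of _ j])
        moreover from 3 have "(\<Prod>j\<in>I. indicator {y..1} (x j)) = (0 :: ennreal)"
          using I by (intro prod_zero) (auto intro!: bexI[of _ j])
        ultimately show ?thesis unfolding f_def by (simp only: mult_zero_left mult_zero_right)
      qed
    qed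
    have fI_meas: "f I y \<in> borel_measurable (?M I)" for y
      using I(2) by (rule f_borel)
    have IH: "(\<integral>\<^sup>+x. f I y x \<partial>?M I) = ennreal ((1 - y) ^ (n + c n) * P)" if "y \<in> {b..1}" for y
      using Suc.hyps(1)[of I y] I Suc.prems that
      by (auto simp: f_def P_def)
    \<comment> \<open>Coordinate \<open>i\<close> is integrated last, so the inner integral falls
      under the induction hypothesis with lower bound \<open>y\<close>.\<close>
    have "(\<integral>\<^sup>+x. f S b x * indicator (D i) x \<partial>?M S) =
        (\<integral>\<^sup>+y. \<integral>\<^sup>+x. f S b (x(i := y)) * indicator (D i) (x(i := y)) \<partial>?M I \<partial>lborel)"
      using f_meas[of b] D_meas[OF i] I
      by (subst I(1), intro lborel_product.product_nn_integral_insert_rev) auto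
    also have "\<dots> = (\<integral>\<^sup>+y. (ennreal ((1 - y) ^ a) * indicator {b..1} y) * (\<integral>\<^sup>+x. f I y x \<partial>?M I) \<partial>lborel)"
      by (simp add: slice nn_integral_cmult fI_meas cong: nn_integral_cong)
    \<comment> \<open>The powers combine because
      \<open>a + (n + c n) = n + c (Suc n)\<close>.\<close>
    also have "\<dots> = (\<integral>\<^sup>+y. ennreal P * (ennreal ((1 - y) ^ (n + c (Suc n))) * indicator {b..1} y) \<partial>lborel)"
      using P_nonneg
      by (intro nn_integral_cong)
         (auto simp: IH c_Suc ennreal_mult[symmetric] power_add mult_ac split: split_indicator)
    also have "\<dots> = ennreal P * ennreal ((1 - b) ^ Suc (n + c (Suc n)) / real (Suc (n + c (Suc n))))"
      using Suc.prems(5) by (simp add: nn_integral_cmult nn_integral_one_minus_power del: power_Suc)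
    also have "\<dots> = ennreal (P * ((1 - b) ^ (Suc n + c (Suc n)) / real (Suc n + c (Suc n))))"
      using P_nonneg Suc.prems(5) by (subst ennreal_mult[symmetric]) auto
    finally show ?thesis .
  qed
  have unique_min: "(\<Sum>i\<in>S. indicator (D i) x) = (1 :: ennreal)"
    if "x \<in> space (?M S)" "inj_on x S" for x
  proof -
    obtain i where i: "i \<in> S" "\<And>j. j \<in> S \<Longrightarrow> x i \<le> x j"
      using S by (metis arg_min_if_finite(1) arg_min_least card.empty nat.simps(3))
    then have "x \<in> D j \<longleftrightarrow> j = i" if "j \<in> S" for j
      using that \<open>x \<in> space _\<close> inj_onD[OF \<open>inj_on x S\<close>, of i j] by (auto simp: D_def intro: antisym)
    then have "(\<Sum>j\<in>S. indicator (D j) x) = (\<Sum>j\<in>S. if j = i then 1 else (0 :: ennreal))"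
      by (intro sum.cong) auto
    then show ?thesis using i S by simp
  qed
  \<comment> \<open>Off the null set of ties the indicators of the pieces add up to
    \<open>1\<close>.\<close>
  have "(\<integral>\<^sup>+x. f S b x \<partial>?M S) = (\<integral>\<^sup>+x. (\<Sum>i\<in>S. f S b x * indicator (D i) x) \<partial>?M S)"
  proof (rule nn_integral_cong_AE)
    show "AE x in ?M S. f S b x = (\<Sum>i\<in>S. f S b x * indicator (D i) x)"
      using AE_PiM_lborel_inj_on[OF S(1)] AE_space
      by eventually_elim (simp add: sum_distrib_left[symmetric] unique_min)
  qed
  also have "\<dots> = (\<Sum>i\<in>S. \<integral>\<^sup>+x. f S b x * indicator (D i) x \<partial>?M S)"
    using f_meas[of b] D_meas by (intro nn_integral_sum) auto
  \<comment> \<open>The number \<open>Suc n\<close> of equal pieces, over the denominator from the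
    integration, is the last factor of the product.\<close>
  also have "\<dots> = of_nat (Suc n) * ennreal (P * ((1 - b) ^ (Suc n + c (Suc n)) / real (Suc n + c (Suc n))))"
    using S by (simp add: part del: power_Suc)
  also have "\<dots> = ennreal (real (Suc n) * (P * ((1 - b) ^ (Suc n + c (Suc n)) / real (Suc n + c (Suc n)))))"
    by (subst ennreal_of_nat_eq_real_of_nat, rule ennreal_mult'[symmetric]) simp
  also have "real (Suc n) * (P * ((1 - b) ^ (Suc n + c (Suc n)) / real (Suc n + c (Suc n)))) =
      (1 - b) ^ (Suc n + c (Suc n)) * (\<Prod>i=1..Suc n. real i / real (i + c i))"
    by (simp add: P_def ac_simps del: power_Suc)
  finally show ?case using S by (simp add: f_def)
qed

section \<open>Reduction of the volume to an integral over the first class\<close>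

text \<open>For fixed \<open>x\<close> on \<open>I\<close> no arc couples two coordinates of
  \<open>J\<close>, so the slice is a box with sides \<open>{0..gap (N k) x}\<close>, where
  \<open>N k\<close> is the set of neighbours of \<open>k\<close>, and its measure is a product of
  lengths.\<close>

lemma emeasure_graph_polytope_bipartite:
  fixes G :: "'a pair_pre_digraph"
  assumes G: "pair_graph G" and V: "pverts G = I \<union> J" "I \<inter> J = {}"
    and arcs: "\<And>x y. (x, y) \<in> parcs G \<Longrightarrow> x \<in> I \<and> y \<in> J \<or> x \<in> J \<and> y \<in> I"
  shows "emeasure (Pi\<^sub>M (pverts G) (\<lambda>_. lborel)) (graph_polytope G) =
    (\<integral>\<^sup>+x. (\<Prod>j\<in>I. indicator {0..1} (x j)) *
        (\<Prod>k\<in>J. ennreal (gap ({j. (j, k) \<in> parcs G} \<inter> I) x)) \<partial>Pi\<^sub>M I (\<lambda>_. lborel))"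
proof -
  interpret pair_graph G by fact
  let ?M = "\<lambda>I. Pi\<^sub>M I (\<lambda>_. lborel :: real measure)"
  let ?N = "\<lambda>k. {j. (j, k) \<in> parcs G} \<inter> I"
  have fin: "finite I" "finite J"
    using finite_verts V by (auto simp: finite_subset)
  have sym: "(x, y) \<in> parcs G" if "(y, x) \<in> parcs G" for x y
    using that arcs_symmetric by blast
  have split: "indicator (graph_polytope G) (merge I J (x, y)) =
      (\<Prod>j\<in>I. indicator {0..1} (x j)) * (\<Prod>k\<in>J. indicator {0..gap (?N k) x} (y k) :: ennreal)"
    if "x \<in> space (?M I)" "y \<in> space (?M J)" for x y
  proof -
    have [simp]: "merge I J (x, y) j = x j" if "j \<in> I" for j using that by (simp add: merge_def)
    have [simp]: "merge I J (x, y) k = y k" if "k \<in> J" for k using that V by (auto simp: merge_def)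
    have "merge I J (x, y) \<in> extensional (I \<union> J)" by simp
    then have "merge I J (x, y) \<in> graph_polytope G \<longleftrightarrow>
        (\<forall>j\<in>I. x j \<in> {0..1}) \<and> (\<forall>k\<in>J. y k \<in> {0..1}) \<and>
        (\<forall>(u, w)\<in>parcs G. merge I J (x, y) u + merge I J (x, y) w \<le> 1)"
      by (simp add: graph_polytope_def V PiE_iff ball_Un)
    \<comment> \<open>Each edge is stored as two arcs, so the arcs from \<open>I\<close> to
      \<open>J\<close> suffice.\<close>
    also have "(\<forall>(u, w)\<in>parcs G. merge I J (x, y) u + merge I J (x, y) w \<le> 1) \<longleftrightarrow>
        (\<forall>k\<in>J. \<forall>j\<in>?N k. y k + x j \<le> 1)"
    proof (intro iffI ballI)
      fix k j assume "\<forall>(u, w)\<in>parcs G. merge I J (x, y) u + merge I J (x, y) w \<le> 1"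
        and "k \<in> J" "j \<in> ?N k"
      then show "y k + x j \<le> 1"
        by (auto dest!: bspec[of _ _ "(j, k)"] simp: add.commute)
    next
      fix e assume *: "\<forall>k\<in>J. \<forall>j\<in>?N k. y k + x j \<le> 1" and "e \<in> parcs G"
      then obtain u w where e: "e = (u, w)" "(u, w) \<in> parcs G" by (cases e) auto
      from arcs[OF e(2)] show "case e of (u, w) \<Rightarrow> merge I J (x, y) u + merge I J (x, y) w \<le> 1"
      proof
        assume "u \<in> I \<and> w \<in> J"
        with * e show ?thesis by (auto simp: add.commute)
      next
        assume "u \<in> J \<and> w \<in> I"
        with * sym[OF e(2)] show ?thesis by (auto simp: e(1))
      qed
    qed
    \<comment> \<open>The constant \<open>1\<close> inside \<open>gap\<close> absorbs the condition
      \<open>y k \<le> 1\<close>.\<close>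
    finally have "merge I J (x, y) \<in> graph_polytope G \<longleftrightarrow>
        (\<forall>j\<in>I. x j \<in> {0..1}) \<and> (\<forall>k\<in>J. y k \<in> {0..gap (?N k) x})"
      using fin by (auto simp: le_gap_iff)
    then show ?thesis
      using fin by (auto simp: indicator_def prod_zero_iff[OF fin(1)] prod_zero_iff[OF fin(2)]
          intro!: prod.neutral)
  qed
  have "emeasure (?M (pverts G)) (graph_polytope G) =
      (\<integral>\<^sup>+x. indicator (graph_polytope G) x \<partial>?M (I \<union> J))"
    using sets_graph_polytope[OF G] by (simp add: V)
  also have "\<dots> = (\<integral>\<^sup>+x. \<integral>\<^sup>+y. indicator (graph_polytope G) (merge I J (x, y)) \<partial>?M J \<partial>?M I)"
    using fin V sets_graph_polytope[OF G]
    by (intro lborel_product.product_nn_integral_fold) auto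
  also have "\<dots> = (\<integral>\<^sup>+x. (\<Prod>j\<in>I. indicator {0..1} (x j)) *
        (\<integral>\<^sup>+y. (\<Prod>k\<in>J. indicator {0..gap (?N k) x} (y k)) \<partial>?M J) \<partial>?M I)"
    by (intro nn_integral_cong) (simp add: split nn_integral_cmult cong: nn_integral_cong)
  \<comment> \<open>If a gap is negative, the interval is empty and \<open>ennreal\<close> truncates
    to the same value \<open>0\<close>.\<close>
  also have "\<dots> = (\<integral>\<^sup>+x. (\<Prod>j\<in>I. indicator {0..1} (x j)) * (\<Prod>k\<in>J. ennreal (gap (?N k) x)) \<partial>?M I)"
    using fin
    by (subst lborel_product.product_nn_integral_prod) (auto simp: ennreal_neg emeasure_lborel_Icc_eq
        intro!: nn_integral_cong arg_cong2[where f = times] prod.cong)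
  finally show ?thesis .
qed

section \<open>Symmetry of the graph and the volume formula\<close>

text \<open>A bijection from \<open>T\<close> to \<open>U\<close> is glued to one between the
  complements, which also have equal size. This extends the symmetry hypothesis to all subsets of a
  given size.\<close>

lemma obtain_permutes_image:
  assumes "finite S" "T \<subseteq> S" "U \<subseteq> S" "card T = card U"
  obtains \<pi> where "\<pi> permutes S" "\<pi> ` T = U"
proof -
  have fin: "finite T" "finite U" using assms finite_subset by auto
  obtain f where f: "bij_betw f T U"
    using fin assms finite_same_card_bij by blast
  have "card (S - T) = card (S - U)" using assms fin by (simp add: card_Diff_subset)
  then obtain g where g: "bij_betw g (S - T) (S - U)"
    using assms finite_same_card_bij by (metis finite_Diff)
  define \<pi> where "\<pi> x = (if x \<in> T then f x else if x \<in> S then g x else x)" for x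
  have 1: "bij_betw \<pi> T U" using f by (subst bij_betw_cong[of _ _ f]) (auto simp: \<pi>_def)
  have 2: "bij_betw \<pi> (S - T) (S - U)" using g by (subst bij_betw_cong[of _ _ g]) (auto simp: \<pi>_def)
  have "bij_betw \<pi> (T \<union> (S - T)) (U \<union> (S - U))"
    using 1 2 by (rule bij_betw_combine) auto
  then have "bij_betw \<pi> S S" using assms by (simp add: Un_absorb1)
  then have "\<pi> permutes S"
    by (rule bij_imp_permutes) (use assms in \<open>auto simp: \<pi>_def\<close>)
  with 1 show ?thesis by (intro that) (auto simp: bij_betw_def)
qed

theorem theorem4p3:
  fixes B :: "(nat + 'b) pair_pre_digraph"
    and n m :: nat
    and v :: "nat \<Rightarrow> 'b"
  assumes simple: "pair_graph B"
    and v_inj: "inj_on v {1..m}"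
    and verts: "pverts B = Inl ` {1..n} \<union> Inr ` v ` {1..m}"
    and bipartite: "\<And>x y. (x, y) \<in> parcs B \<Longrightarrow>
          (x \<in> Inl ` {1..n} \<and> y \<in> Inr ` v ` {1..m}) \<or>
          (x \<in> Inr ` v ` {1..m} \<and> y \<in> Inl ` {1..n})"
    and symmetric: "\<And>\<pi>. \<pi> permutes {1..n} \<Longrightarrow>
          \<exists>\<sigma>. \<sigma> permutes (v ` {1..m}) \<and> graph_automorphism B (map_sum \<pi> \<sigma>)"
  shows "\<exists>\<alpha> :: nat \<Rightarrow> nat.
           (\<forall>i\<in>{1..n}. \<forall>\<sigma>. \<sigma> permutes {1..n} \<longrightarrow> bip_alpha B n m v i \<sigma> = \<alpha> i) \<and>
           graph_volume B = fact n * (\<Prod>i=1..n. 1 / (real i + (\<Sum>j=1..i. real (\<alpha> j))))"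
proof -
  interpret pair_graph B by fact
  let ?V = "{1..n}" and ?W = "v ` {1..m}"
  \<comment> \<open>\<open>H T\<close> is the joint neighbourhood of \<open>T\<close> in the second
    class. Its size will turn out to depend on \<open>card T\<close> only, so \<open>c\<close> may
    be read off from the initial segments.\<close>
  define H where "H T = {w \<in> ?W. \<exists>j\<in>T. (Inl j, Inr w) \<in> parcs B}" for T
  define c where "c i = card (H {1..i})" for i
  have H_fin [simp]: "finite (H T)" for T by (simp add: H_def)
  have H_perm: "card (H (\<pi> ` T)) = card (H T)" if \<pi>: "\<pi> permutes ?V" and T: "T \<subseteq> ?V" for \<pi> T
  proof -
    obtain \<sigma> where \<sigma>: "\<sigma> permutes ?W" and aut: "graph_automorphism B (map_sum \<pi> \<sigma>)"
      using symmetric[OF \<pi>] by blast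
    have arc: "(Inl j, Inr w) \<in> parcs B \<longleftrightarrow> (Inl (\<pi> j), Inr (\<sigma> w)) \<in> parcs B"
      if "j \<in> ?V" "w \<in> ?W" for j w
      using aut that unfolding graph_automorphism_def verts by fastforce
    \<comment> \<open>An automorphism carries neighbourhoods to neighbourhoods.\<close>
    have "H (\<pi> ` T) = \<sigma> ` H T"
    proof (intro equalityI subsetI)
      fix w assume "w \<in> H (\<pi> ` T)"
      then obtain j where j: "w \<in> ?W" "j \<in> T" "(Inl (\<pi> j), Inr w) \<in> parcs B"
        by (auto simp: H_def)
      obtain w' where w': "w' \<in> ?W" "w = \<sigma> w'"
        using j(1) permutes_image[OF \<sigma>] by blast
      have "(Inl j, Inr w') \<in> parcs B"
        using arc[of j w'] j w' T by auto
      then show "w \<in> \<sigma> ` H T"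
        using j w' unfolding H_def by blast
    next
      fix w assume "w \<in> \<sigma> ` H T"
      then obtain w' j where "w = \<sigma> w'" "w' \<in> ?W" "j \<in> T" "(Inl j, Inr w') \<in> parcs B"
        unfolding H_def by blast
      then show "w \<in> H (\<pi> ` T)"
        using arc[of j w'] T permutes_in_image[OF \<sigma>] unfolding H_def by blast
    qed
    then show ?thesis
      using permutes_inj[OF \<sigma>] by (simp add: card_image inj_on_subset)
  qed
  have H_card: "card (H T) = c (card T)" if T: "T \<subseteq> ?V" for T
  proof -
    have "card T \<le> n" using card_mono[OF _ T] by simp
    then obtain \<pi> where "\<pi> permutes ?V" "\<pi> ` {1..card T} = T"
      using obtain_permutes_image[of ?V "{1..card T}" T] T by auto
    then show ?thesis
      using H_perm[of \<pi> "{1..card T}"] \<open>card T \<le> n\<close> by (simp add: c_def)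
  qed
  \<comment> \<open>The vertices counted are those that join the neighbourhood when
    \<open>\<sigma> i\<close> is added to the earlier values of \<open>\<sigma>\<close>.
    Monotonicity of \<open>c\<close> is recorded because subtraction of naturals truncates.\<close>
  have alpha: "bip_alpha B n m v i \<sigma> = c i - c (i - 1)" "c (i - 1) \<le> c i"
    if i: "i \<in> ?V" and \<sigma>: "\<sigma> permutes ?V" for i \<sigma>
  proof -
    \<comment> \<open>\<open>bip_nbrs\<close> is restricted to \<open>{1..n}\<close> while
      \<open>H\<close> is not; they agree because \<open>\<sigma>\<close> maps \<open>{1..n}\<close>
      to itself.\<close>
    have nb: "{v k | k. k \<in> {1..m} \<and> \<sigma> j \<in> bip_nbrs B n v k} = H {\<sigma> j}" if "j \<in> ?V" for j
      using permutes_in_image[OF \<sigma>, of j] that by (auto simp: bip_nbrs_def H_def)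
    have "bip_alpha B n m v i \<sigma> = card (H {\<sigma> i} - (\<Union>j\<in>{1..<i}. H {\<sigma> j}))"
      unfolding bip_alpha_def using i
      by (intro arg_cong[where f = card] arg_cong2[where f = minus] SUP_cong nb) auto
    also have "H {\<sigma> i} - (\<Union>j\<in>{1..<i}. H {\<sigma> j}) = H (\<sigma> ` {1..i}) - H (\<sigma> ` {1..i-1})"
    proof -
      have "{1..i} = insert i {1..<i}" "{1..i-1} = {1..<i}" using i by auto
      then show ?thesis by (auto simp: H_def)
    qed
    finally have 1: "bip_alpha B n m v i \<sigma> = card (H (\<sigma> ` {1..i}) - H (\<sigma> ` {1..i-1}))" .
    have 2: "H (\<sigma> ` {1..i-1}) \<subseteq> H (\<sigma> ` {1..i})"
      by (force simp: H_def)
    have 3: "card (H (\<sigma> ` {1..i})) = c i" "card (H (\<sigma> ` {1..i-1})) = c (i - 1)"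
      using i le_diff_conv[of i 1 n] H_perm[OF \<sigma>, of "{1..i}"] H_perm[OF \<sigma>, of "{1..i-1}"]
      by (auto simp: c_def atLeastatMost_subset_iff)
    show "bip_alpha B n m v i \<sigma> = c i - c (i - 1)"
      using 1 2 3 by (simp add: card_Diff_subset)
    show "c (i - 1) \<le> c i"
      using card_mono[OF _ 2] 3 by simp
  qed
  \<comment> \<open>The sum telescopes from \<open>c 0 = 0\<close>, every difference being exact by
    monotonicity.\<close>
  have alpha_sum: "(\<Sum>j=1..i. real (c j - c (j - 1))) = real (c i)" if "i \<le> n" for i
    using that
  proof (induction i)
    case 0
    show ?case by (simp add: c_def H_def)
  next
    case (Suc i)
    then show ?case using alpha(2)[of "Suc i" id] by (simp add: permutes_id)
  qed
  let ?I = "Inl ` ?V :: (nat + 'b) set" and ?J = "Inr ` ?W :: (nat + 'b) set"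
  \<comment> \<open>This is the counting hypothesis of \<open>nn_integral_prod_gap\<close>, with the
    second class as \<open>K\<close> and the neighbours of \<open>k\<close> as
    \<open>N k\<close>.\<close>
  have card_nbrs: "card {k \<in> ?J. {j. (j, k) \<in> parcs B} \<inter> T \<noteq> {}} = c (card T)" if "T \<subseteq> ?I" for T
  proof -
    obtain U where U: "U \<subseteq> ?V" "T = Inl ` U" using \<open>T \<subseteq> ?I\<close> by (auto simp: subset_image_iff)
    have "{k \<in> ?J. {j. (j, k) \<in> parcs B} \<inter> T \<noteq> {}} = Inr ` H U"
      unfolding U(2) by (auto simp: H_def)
    then show ?thesis using U by (simp add: card_image H_card)
  qed
  have card_I: "card ?I = n" by (simp add: card_image)
  have disj: "?I \<inter> ?J = {}" by auto
  have "emeasure (Pi\<^sub>M (pverts B) (\<lambda>_. lborel)) (graph_polytope B) =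
      (\<integral>\<^sup>+x. (\<Prod>j\<in>?I. indicator {0..1} (x j)) *
        (\<Prod>k\<in>?J. ennreal (gap ({j. (j, k) \<in> parcs B} \<inter> ?I) x)) \<partial>Pi\<^sub>M ?I (\<lambda>_. lborel))"
    using simple verts disj bipartite by (rule emeasure_graph_polytope_bipartite)
  \<comment> \<open>With lower bound \<open>b = 0\<close> the power has base \<open>1\<close> and
    disappears.\<close>
  also have "\<dots> = ennreal ((1 - 0) ^ (card ?I + c (card ?I)) *
      (\<Prod>i=1..card ?I. real i / real (i + c i)))"
    by (rule nn_integral_prod_gap) (use card_nbrs in simp_all)
  also have "\<dots> = ennreal (\<Prod>i=1..n. real i / real (i + c i))"
    by (simp only: card_I) simp
  finally have "emeasure (Pi\<^sub>M (pverts B) (\<lambda>_. lborel)) (graph_polytope B) =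
      ennreal (\<Prod>i=1..n. real i / real (i + c i))" .
  then have "graph_volume B = (\<Prod>i=1..n. real i / real (i + c i))"
    by (simp add: graph_volume_def measure_def prod_nonneg)
  also have "\<dots> = fact n * (\<Prod>i=1..n. 1 / real (i + c i))"
    by (simp add: prod_dividef fact_prod)
  also have "(\<Prod>i=1..n. 1 / real (i + c i)) =
      (\<Prod>i=1..n. 1 / (real i + (\<Sum>j=1..i. real (c j - c (j - 1)))))"
    by (intro prod.cong refl, subst alpha_sum) auto
  finally show ?thesis
    using alpha(1) by (intro exI[of _ "\<lambda>i. c i - c (i - 1)"]) blast
qed

end
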